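(* Let $k\geq 4$ and $0\leq \alpha\leq k-2$ be integers. Let $A$ be a set of $k$ positive integers such that \[|\Sigma_{\alpha}(A)|=\frac{k(k+1)}{2}-\frac{\alpha(\alpha+1)}{2}+1.\] Then $A=d*[1,k]$ for some positive integer $d$.
   Context: For a finite set $A$ of integers with $|A|=k$ and an integer $0\leq\alpha\leq k$, $\Sigma_{\alpha}(A)=\{s(B): B\subseteq A,\ |B|\geq \alpha\}$, where $s(B)=\sum_{b\in B} b$ and $s(\emptyset)=0$. For integers $a\leq b$, $[a,b]=\{a,a+1,\ldots,b\}$, and for an integer $d$ and a set $X$, $d*X=\{dx: x\in X\}$. *)

theory Defs
  imports Complex_Main
begin

definition subset_sums_ge :: "nat \<Rightarrow> int set \<Rightarrow> int set"
  where "subset_sums_ge \<alpha> A = {\<Sum>B | B. B \<subseteq> A \<and> \<alpha> \<le> card B}"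

definition dilate :: "int \<Rightarrow> int set \<Rightarrow> int set"
  where "dilate d X = {d * x | x. x \<in> X}"

end

theory Submission
  imports Defs
begin

text \<open>
  Passing to complements, the sums of at least \<open>\<alpha>\<close> elements become the sums of at most
  \<open>m = k - \<alpha> \<ge> 2\<close> elements. Let \<open>M\<close> be the maximum of the set and \<open>A\<close> the set of the other
  elements. The sums of at most \<open>m\<close> elements contain the disjoint sets \<open>{0} \<union> A\<close> and
  \<open>M +\<close> (sums of at most \<open>m - 1\<close> elements of \<open>A\<close>), which gives the lower bound
  \<open>1 + k + (k - 1) + \<dots> + (k - m + 1)\<close> by induction. Equality is inherited by \<open>A\<close> and forces every
  sum of two distinct elements of \<open>A\<close> to lie in \<open>A \<union> {M} \<union> (M + A)\<close>. With \<open>a < b\<close> the two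
  least elements, the sums \<open>a + x\<close> are too small for \<open>M + A\<close>, and counting them shows that
  subtracting \<open>a\<close> preserves \<open>A \<union> {M}\<close> except at \<open>a\<close> and \<open>b\<close>. In particular
  \<open>M - a \<in> A\<close>. Since \<open>b + (M - a)\<close> exceeds \<open>M\<close>, it lies in \<open>M + A\<close>, that is, \<open>b - a \<in> A\<close>.
  Descending from \<open>M\<close> in steps of \<open>a\<close> now exhausts the set.
\<close>

definition subset_sums_le :: "nat \<Rightarrow> 'a::comm_monoid_add set \<Rightarrow> 'a set"
  where "subset_sums_le m A = {\<Sum>B | B. B \<subseteq> A \<and> card B \<le> m}"

text \<open>The truncated subtraction makes the terms with \<open>i \<ge> card A\<close> vanish, so the value
  is the right one for \<open>m > card A\<close> as well.\<close>

definition minimal_subset_sums_le :: "nat \<Rightarrow> 'a::comm_monoid_add set \<Rightarrow> bool"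
  where "minimal_subset_sums_le m A \<longleftrightarrow>
    card (subset_sums_le m A) = Suc (\<Sum>i<m. card A - i)"

lemma subset_sums_leI: "B \<subseteq> A \<Longrightarrow> card B \<le> m \<Longrightarrow> \<Sum>B \<in> subset_sums_le m A"
  by (auto simp: subset_sums_le_def)

lemma zero_in_subset_sums_le: "0 \<in> subset_sums_le m A"
  using subset_sums_leI[of "{}" A m] by simp

lemma finite_subset_sums_le: "finite A \<Longrightarrow> finite (subset_sums_le m A)"
  by (rule finite_subset[of _ "Sum ` Pow A"]) (auto simp: subset_sums_le_def)

lemma subset_sums_le_nonneg:
  fixes A :: "'a::ordered_comm_monoid_add set"
  assumes "\<forall>a\<in>A. 0 < a" "x \<in> subset_sums_le m A"
  shows "0 \<le> x"
  using assms by (force simp: subset_sums_le_def intro!: sum_nonneg)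

lemma subset_sums_ge_eq_image_subset_sums_le:
  assumes "finite A" "\<alpha> \<le> card A"
  shows "subset_sums_ge \<alpha> A = (-) (\<Sum>A) ` subset_sums_le (card A - \<alpha>) A"
proof -
  let ?small = "{B. B \<subseteq> A \<and> card B \<le> card A - \<alpha>}"
  have "B \<in> (-) A ` ?small" if "B \<subseteq> A" "\<alpha> \<le> card B" for B
  proof (rule image_eqI)
    show "B = A - (A - B)" using that(1) by blast
    show "A - B \<in> ?small"
      using assms(1) that by (auto simp: card_Diff_subset finite_subset)
  qed
  moreover have "\<alpha> \<le> card (A - B)" if "B \<in> ?small" for B
    using assms that by (auto simp: card_Diff_subset finite_subset)
  ultimately have "{B. B \<subseteq> A \<and> \<alpha> \<le> card B} = (-) A ` ?small" by blast
  then have "subset_sums_ge \<alpha> A = (\<lambda>B. \<Sum>(A - B)) ` ?small"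
    unfolding subset_sums_ge_def by (simp add: setcompr_eq_image image_image)
  also have "\<dots> = (\<lambda>B. \<Sum>A - \<Sum>B) ` ?small"
    using assms(1) by (intro image_cong) (auto simp: sum_diff)
  also have "\<dots> = (-) (\<Sum>A) ` subset_sums_le (card A - \<alpha>) A"
    by (simp add: subset_sums_le_def setcompr_eq_image image_image)
  finally show ?thesis .
qed

lemma card_subset_sums_ge:
  assumes "finite A" "\<alpha> \<le> card A"
  shows "card (subset_sums_ge \<alpha> A) = card (subset_sums_le (card A - \<alpha>) A)"
  unfolding subset_sums_ge_eq_image_subset_sums_le[OF assms] by (simp add: card_image inj_on_def)

lemma sum_lessThan_diff_closed_form:
  assumes "\<alpha> \<le> k"
  shows "real (\<Sum>i<k - \<alpha>. k - i) = real k * (real k + 1) / 2 - real \<alpha> * (real \<alpha> + 1) / 2"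
  using assms
proof (induction k rule: dec_induct)
  case (step k)
  then have "(\<Sum>i<Suc k - \<alpha>. Suc k - i) = Suc k + (\<Sum>i<k - \<alpha>. k - i)"
    using Suc_diff_le[of \<alpha> k] by (simp add: sum.lessThan_Suc_shift del: sum.lessThan_Suc)
  then show ?case using step.IH by (simp add: field_simps)
qed simp

lemma subset_sums_le_insert_superset:
  assumes "finite A" "M \<notin> A"
  shows "insert 0 A \<union> (+) M ` subset_sums_le m A \<subseteq> subset_sums_le (Suc m) (insert M A)"
proof -
  have "x \<in> subset_sums_le (Suc m) (insert M A)" if "x \<in> A" for x
    using subset_sums_leI[of "{x}"] that by auto
  moreover have "M + \<Sum>B \<in> subset_sums_le (Suc m) (insert M A)"
    if "B \<subseteq> A" "card B \<le> m" for B
  proof -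
    have "finite B" "M \<notin> B" using assms that(1) by (auto intro: finite_subset)
    then show ?thesis using subset_sums_leI[of "insert M B" "insert M A" "Suc m"] that by auto
  qed
  ultimately show ?thesis
    using zero_in_subset_sums_le by (auto simp: subset_sums_le_def[of m])
qed

lemma card_insert_zero_Un_translate_subset_sums_le:
  fixes A :: "'a::{linorder, ordered_cancel_comm_monoid_add} set"
  assumes "finite A" and pos: "\<forall>a\<in>insert M A. 0 < a" and max: "\<forall>a\<in>A. a < M"
  shows "card (insert 0 A \<union> (+) M ` subset_sums_le m A)
    = Suc (card A) + card (subset_sums_le m A)"
proof -
  have "x < M" if "x \<in> insert 0 A" for x using that pos max by auto
  moreover have "M \<le> M + y" if "y \<in> subset_sums_le m A" for y
    using subset_sums_le_nonneg[OF _ that] pos by (simp add: add_increasing2)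
  ultimately have "insert 0 A \<inter> (+) M ` subset_sums_le m A = {}" by force
  then have "card (insert 0 A \<union> (+) M ` subset_sums_le m A)
      = card (insert 0 A) + card ((+) M ` subset_sums_le m A)"
    using assms(1) by (intro card_Un_disjoint) (simp_all add: finite_subset_sums_le)
  moreover have "0 \<notin> A" using pos by auto
  ultimately show ?thesis using assms(1) by (simp add: card_image)
qed

lemma card_subset_sums_le_insert_ge:
  fixes A :: "'a::{linorder, ordered_cancel_comm_monoid_add} set"
  assumes "finite A" "\<forall>a\<in>insert M A. 0 < a" "\<forall>a\<in>A. a < M"
  shows "Suc (card A) + card (subset_sums_le m A) \<le> card (subset_sums_le (Suc m) (insert M A))"
proof -
  have "M \<notin> A" using assms(3) by blast
  then show ?thesis
    unfolding card_insert_zero_Un_translate_subset_sums_le[OF assms, symmetric]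
    using assms(1) by (intro card_mono subset_sums_le_insert_superset finite_subset_sums_le) auto
qed

lemma sum_diff_card_insert:
  assumes "finite A" "M \<notin> A"
  shows "(\<Sum>i<Suc m. card (insert M A) - i) = Suc (card A) + (\<Sum>i<m. card A - i)"
  using assms by (simp add: sum.lessThan_Suc_shift del: sum.lessThan_Suc)

theorem card_subset_sums_le_gt:
  fixes A :: "'a::{linorder, ordered_cancel_comm_monoid_add} set"
  assumes "finite A" "\<forall>a\<in>A. 0 < a"
  shows "(\<Sum>i<m. card A - i) < card (subset_sums_le m A)"
  using assms
proof (induction A arbitrary: m rule: finite_linorder_max_induct)
  case empty
  show ?case
    using zero_in_subset_sums_le finite_subset_sums_le[of "{}" m] by (auto simp: card_gt_0_iff)
next
  case (insert M A)
  show ?case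
  proof (cases m)
    case 0
    then show ?thesis
      using zero_in_subset_sums_le finite_subset_sums_le[of "insert M A" m] insert.hyps(1)
      by (auto simp: card_gt_0_iff)
  next
    case (Suc n)
    have "M \<notin> A" using insert.hyps(2) by blast
    with insert.hyps(1) have "(\<Sum>i<m. card (insert M A) - i) = Suc (card A) + (\<Sum>i<n. card A - i)"
      unfolding Suc by (rule sum_diff_card_insert)
    also have "\<dots> < Suc (card A) + card (subset_sums_le n A)"
      using insert.IH insert.prems by simp
    also have "\<dots> \<le> card (subset_sums_le m (insert M A))"
      unfolding Suc using insert.hyps insert.prems by (intro card_subset_sums_le_insert_ge)
    finally show ?thesis .
  qed
qed

lemma minimal_subset_sums_le_insertD:
  fixes A :: "'a::{linorder, ordered_cancel_comm_monoid_add} set"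
  assumes fin: "finite A" and pos: "\<forall>a\<in>insert M A. 0 < a" and max: "\<forall>a\<in>A. a < M"
    and minimal: "minimal_subset_sums_le (Suc m) (insert M A)"
  shows "minimal_subset_sums_le m A"
    and "subset_sums_le (Suc m) (insert M A) = insert 0 A \<union> (+) M ` subset_sums_le m A"
proof -
  have "M \<notin> A" using max by blast
  have card: "card (subset_sums_le (Suc m) (insert M A))
      = Suc (Suc (card A) + (\<Sum>i<m. card A - i))"
    using minimal
    unfolding minimal_subset_sums_le_def sum_diff_card_insert[OF fin \<open>M \<notin> A\<close>] .
  moreover have "(\<Sum>i<m. card A - i) < card (subset_sums_le m A)"
    using fin pos by (intro card_subset_sums_le_gt) auto
  ultimately show minimal_A: "minimal_subset_sums_le m A"
    using card_subset_sums_le_insert_ge[OF fin pos max, of m]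
    unfolding minimal_subset_sums_le_def by linarith
  show "subset_sums_le (Suc m) (insert M A) = insert 0 A \<union> (+) M ` subset_sums_le m A"
  proof (rule card_subset_eq[symmetric])
    show "finite (subset_sums_le (Suc m) (insert M A))"
      using fin by (simp add: finite_subset_sums_le)
    show "insert 0 A \<union> (+) M ` subset_sums_le m A \<subseteq> subset_sums_le (Suc m) (insert M A)"
      using fin \<open>M \<notin> A\<close> by (rule subset_sums_le_insert_superset)
    show "card (insert 0 A \<union> (+) M ` subset_sums_le m A)
        = card (subset_sums_le (Suc m) (insert M A))"
      using card card_insert_zero_Un_translate_subset_sums_le[OF fin pos max, of m] minimal_A
      unfolding minimal_subset_sums_le_def by simp
  qed
qed

lemma minimal_subset_sums_le_mem_if_le:
  fixes A :: "'a::{linorder, ordered_cancel_comm_monoid_add} set"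
  assumes fin: "finite A" and pos: "\<forall>a\<in>A. 0 < a"
    and minimal: "minimal_subset_sums_le (Suc m) A"
    and s: "s \<in> subset_sums_le (Suc m) A" and "s \<le> b" "b \<in> A"
  shows "s \<in> insert 0 A"
proof -
  define M A' where "M = Max A" and "A' = A - {M}"
  have "b \<le> M" using fin \<open>b \<in> A\<close> by (simp add: M_def)
  have "M \<in> A" using Max_in[OF fin] \<open>b \<in> A\<close> by (auto simp: M_def)
  then have A: "A = insert M A'" by (auto simp: A'_def)
  have max: "\<forall>a\<in>A'. a < M" using fin by (auto simp: A'_def M_def less_le)
  have "s \<in> insert 0 A' \<union> (+) M ` subset_sums_le m A'"
    using s minimal_subset_sums_le_insertD(2)[of A' M m] fin pos max minimal by (simp add: A)
  then consider (low) "s \<in> insert 0 A'" | (high) t where "t \<in> subset_sums_le m A'" "s = M + t" by blast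
  then show ?thesis
  proof cases
    case low
    then show ?thesis by (auto simp: A)
  next
    case high
    then have "0 \<le> t" using pos by (auto simp: A intro: subset_sums_le_nonneg)
    then have "M \<le> s" using high(2) by (simp add: add_increasing2)
    then have "s = M" using \<open>s \<le> b\<close> \<open>b \<le> M\<close> by simp
    then show ?thesis using \<open>M \<in> A\<close> by simp
  qed
qed

lemma minimal_subset_sums_le_pair_sum:
  fixes A :: "'a::{linorder, ordered_cancel_comm_monoid_add} set"
  assumes fin: "finite A" and pos: "\<forall>a\<in>insert M A. 0 < a" and max: "\<forall>a\<in>A. a < M"
    and minimal: "minimal_subset_sums_le m (insert M A)" and "2 \<le> m"
    and xy: "x \<in> A" "y \<in> A" "x \<noteq> y"
  shows "x + y \<in> insert M A \<union> (+) M ` A"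
proof -
  obtain n where m: "m = Suc (Suc n)"
    using \<open>2 \<le> m\<close> by (metis Suc_le_D numeral_2_eq_2 Suc_le_mono)
  note split = minimal_subset_sums_le_insertD[OF fin pos max minimal[unfolded m]]
  have "0 < x + y" using pos xy by (auto intro: add_pos_pos)
  have "x + y \<in> subset_sums_le m (insert M A)"
    using subset_sums_leI[of "{x, y}" "insert M A" m] xy \<open>2 \<le> m\<close> by auto
  then consider (low) "x + y \<in> A" | (high) s where "s \<in> subset_sums_le (Suc n) A" "x + y = M + s"
    using \<open>0 < x + y\<close> unfolding m split(2) by auto
  then show ?thesis
  proof cases
    case low
    then show ?thesis by blast
  next
    case high
    have "s \<le> y"
    proof (rule ccontr)
      assume "\<not> s \<le> y"
      then have "x + y < M + s" using max xy(1) by (auto intro: add_strict_mono)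
      then show False using high(2) by simp
    qed
    then have "s \<in> insert 0 A"
      using minimal_subset_sums_le_mem_if_le[OF fin _ split(1) high(1)] pos xy(2) by blast
    then show ?thesis using high(2) by auto
  qed
qed

lemma eq_multiples_if_closed_under_diff:
  fixes A :: "'a::linordered_idom set"
  assumes "finite A" "\<forall>x\<in>A. 0 < x" "0 < a"
    and "\<forall>x\<in>A. x \<noteq> a \<longrightarrow> x - a \<in> A"
  shows "A = (\<lambda>i. a * of_nat i) ` {1..card A}"
  using assms(1,2,4)
proof (induction A rule: finite_linorder_max_induct)
  case empty
  show ?case by simp
next
  case (insert M A)
  have "M \<notin> A" using insert.hyps(2) by blast
  have "x - a \<noteq> M" if "x \<in> A" for x
    using insert.hyps(2) \<open>0 < a\<close> that by force
  then have A: "A = (\<lambda>i. a * of_nat i) ` {1..card A}"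
    using insert.prems by (intro insert.IH) auto
  have "\<exists>j\<le>card A. M = a * of_nat (Suc j)"
  proof (cases "M = a")
    case True
    then show ?thesis by (intro exI[of _ 0]) simp
  next
    case False
    then have "M - a \<in> A" using insert.prems(2) \<open>0 < a\<close> by auto
    then have "M - a \<in> (\<lambda>i. a * of_nat i) ` {1..card A}" unfolding A[symmetric] .
    then obtain j where "j \<le> card A" "M - a = a * of_nat j" by auto
    then show ?thesis by (intro exI[of _ j]) (simp add: algebra_simps)
  qed
  then obtain j where j: "j \<le> card A" "M = a * of_nat (Suc j)" by blast
  have "Suc j \<notin> {1..card A}" using \<open>M \<notin> A\<close> A j(2) by blast
  then have "j = card A" using j(1) by simp
  then have "M = a * of_nat (Suc (card A))" using j(2) by simp
  then have "insert M A = (\<lambda>i. a * of_nat i) ` insert (Suc (card A)) {1..card A}"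
    using A by simp
  also have "insert (Suc (card A)) {1..card A} = {1..card (insert M A)}"
    using insert.hyps(1) \<open>M \<notin> A\<close> by (simp add: atLeastAtMostSuc_conv)
  finally show ?case .
qed

lemma translate_eq_if_pair_sums:
  fixes A :: "'a::linordered_ab_group_add set"
  assumes fin: "finite A" and pos: "\<forall>x\<in>A. 0 < x" and max: "\<forall>x\<in>A. x < M"
    and pair: "\<And>x y. x \<in> A \<Longrightarrow> y \<in> A \<Longrightarrow> x \<noteq> y \<Longrightarrow> x + y \<in> insert M A \<union> (+) M ` A"
    and a: "a \<in> A" "\<forall>x\<in>A. a \<le> x" and b: "b \<in> A - {a}" "\<forall>x\<in>A - {a}. b \<le> x"
  shows "(+) a ` (A - {a}) = insert M A - {a, b}"
proof (rule card_subset_eq)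
  have "a + x \<in> insert M A - {a, b}" if x: "x \<in> A - {a}" for x
  proof -
    have "a + x < M + z" if "z \<in> A" for z
      using add_less_le_mono[of x M a z] that a(2) max x by (simp add: add.commute)
    then have "a + x \<notin> (+) M ` A" by force
    then have "a + x \<in> insert M A" using pair[of a x] a(1) x by auto
    moreover have "a < a + x" using pos x by simp
    moreover have "b < a + x" using pos a(1) b(2) x by (simp add: add_strict_increasing)
    ultimately show ?thesis by auto
  qed
  then show "(+) a ` (A - {a}) \<subseteq> insert M A - {a, b}" by (rule image_subsetI)
  have "M \<notin> A" using max by blast
  have "card ((+) a ` (A - {a})) = card (A - {a})" by (simp add: card_image)
  also have "\<dots> = card (insert M A) - card {a, b}"
    using fin a(1) b(1) \<open>M \<notin> A\<close> by (auto simp: card_insert_if)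
  also have "\<dots> = card (insert M A - {a, b})"
    using a(1) b(1) by (intro card_Diff_subset[symmetric]) auto
  finally show "card ((+) a ` (A - {a})) = card (insert M A - {a, b})" .
qed (use fin in simp)

lemma closed_under_diff_Min_if_pair_sums:
  fixes A :: "'a::linordered_ab_group_add set"
  assumes fin: "finite A" and "3 \<le> card A"
    and pos: "\<forall>x\<in>A. 0 < x" and max: "\<forall>x\<in>A. x < M"
    and pair: "\<And>x y. x \<in> A \<Longrightarrow> y \<in> A \<Longrightarrow> x \<noteq> y \<Longrightarrow> x + y \<in> insert M A \<union> (+) M ` A"
  shows "\<forall>x\<in>insert M A. x \<noteq> Min A \<longrightarrow> x - Min A \<in> insert M A"
proof -
  define a b where "a = Min A" and "b = Min (A - {a})"
  have "A \<noteq> {}" using \<open>3 \<le> card A\<close> by auto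
  then have a: "a \<in> A" "\<forall>x\<in>A. a \<le> x" using fin by (auto simp: a_def)
  have card_rest: "2 \<le> card (A - {a})" using \<open>3 \<le> card A\<close> a(1) fin by simp
  then have "A - {a} \<noteq> {}" by force
  then have b: "b \<in> A - {a}" "\<forall>x\<in>A - {a}. b \<le> x"
    using fin Min_in[of "A - {a}"] by (auto simp: b_def)
  have "a < b" using a(2) b(1) by force
  have translate: "(+) a ` (A - {a}) = insert M A - {a, b}"
    using translate_eq_if_pair_sums[OF fin pos max pair a b] .
  have diff: "x - a \<in> A - {a}" if "x \<in> insert M A - {a, b}" for x
    using that unfolding translate[symmetric] by auto
  have M_diff: "M - a \<in> A - {a}" using max a(1) b(1) by (intro diff) auto
  have "M - a \<noteq> b"
  proof
    assume "M - a = b"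
    have "x = b" if x: "x \<in> A - {a}" for x
    proof -
      have "a + x \<in> insert M A" using translate x by blast
      then have "a + x \<le> M" using max by auto
      also have "M = a + b" using \<open>M - a = b\<close> by (simp add: algebra_simps)
      finally show ?thesis using b(2) x by force
    qed
    then have "card (A - {a}) \<le> card {b}" by (intro card_mono) auto
    then show False using card_rest by simp
  qed
  then have "b + (M - a) \<in> insert M A \<union> (+) M ` A"
    using pair b(1) M_diff by blast
  moreover have "M < b + (M - a)" using \<open>a < b\<close> by (simp add: algebra_simps)
  then have "b + (M - a) \<notin> insert M A" using max by auto
  ultimately obtain z where "z \<in> A" "b + (M - a) = M + z" by blast
  then have "b - a \<in> A" by (simp add: algebra_simps)
  then show ?thesis using diff by (auto simp: a_def)
qed

theorem minimal_subset_sums_le_imp_multiples: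
  fixes A :: "'a::linordered_idom set"
  assumes fin: "finite A" and "4 \<le> card A" and pos: "\<forall>a\<in>A. 0 < a"
    and "2 \<le> m" and minimal: "minimal_subset_sums_le m A"
  shows "\<exists>d>0. A = (\<lambda>i. d * of_nat i) ` {1..card A}"
proof -
  define M A' where "M = Max A" and "A' = A - {M}"
  have "A \<noteq> {}" using \<open>4 \<le> card A\<close> by auto
  then have "M \<in> A" using fin by (simp add: M_def)
  then have A: "A = insert M A'" by (auto simp: A'_def)
  have max: "\<forall>x\<in>A'. x < M" using fin by (auto simp: A'_def M_def less_le)
  have fin_A': "finite A'" and card_A': "3 \<le> card A'"
    using fin \<open>4 \<le> card A\<close> \<open>M \<in> A\<close> by (auto simp: A'_def)
  have pair: "x + y \<in> insert M A' \<union> (+) M ` A'" if "x \<in> A'" "y \<in> A'" "x \<noteq> y" for x y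
    using fin_A' pos max minimal \<open>2 \<le> m\<close> that unfolding A by (rule minimal_subset_sums_le_pair_sum)
  have closed: "\<forall>x\<in>A. x \<noteq> Min A' \<longrightarrow> x - Min A' \<in> A"
    using closed_under_diff_Min_if_pair_sums[OF fin_A' card_A' _ max pair] pos unfolding A by blast
  have "Min A' \<in> A'" using fin_A' card_A' by (intro Min_in) auto
  then have "0 < Min A'" using pos by (auto simp: A)
  then show ?thesis using eq_multiples_if_closed_under_diff[OF fin pos _ closed] by blast
qed

lemma image_mult_of_nat_eq_dilate: "(\<lambda>i. d * of_nat i) ` {1..k} = dilate d {1..int k}"
proof -
  have "dilate d {1..int k} = (*) d ` int ` {1..k}"
    unfolding dilate_def by (auto simp: image_int_atLeastAtMost)
  then show ?thesis by (simp add: image_image)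
qed

theorem theorem2p2:
  fixes k \<alpha> :: nat and A :: "int set"
  assumes "4 \<le> k"
    and "\<alpha> \<le> k - 2"
    and "finite A"
    and "card A = k"
    and "\<forall>a\<in>A. 0 < a"
    and "real (card (subset_sums_ge \<alpha> A)) =
      real k * (real k + 1) / 2 - real \<alpha> * (real \<alpha> + 1) / 2 + 1"
  shows "\<exists>d::int. 0 < d \<and> A = dilate d {1..int k}"
proof -
  have "\<alpha> \<le> k" "2 \<le> k - \<alpha>" using assms(1,2) by auto
  have "real (card (subset_sums_ge \<alpha> A)) = real (Suc (\<Sum>i<k - \<alpha>. k - i))"
    unfolding of_nat_Suc sum_lessThan_diff_closed_form[OF \<open>\<alpha> \<le> k\<close>] using assms(6) by simp
  then have "card (subset_sums_ge \<alpha> A) = Suc (\<Sum>i<k - \<alpha>. k - i)"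
    by (simp only: of_nat_eq_iff)
  then have minimal: "minimal_subset_sums_le (k - \<alpha>) A"
    using card_subset_sums_ge[of A \<alpha>] assms(3,4) \<open>\<alpha> \<le> k\<close>
    by (simp add: minimal_subset_sums_le_def)
  have "\<exists>d>0. A = (\<lambda>i. d * of_nat i) ` {1..k}"
    using minimal_subset_sums_le_imp_multiples[OF assms(3) _ assms(5) \<open>2 \<le> k - \<alpha>\<close> minimal]
      assms(1,4) by simp
  then show ?thesis
    by (simp only: image_mult_of_nat_eq_dilate)
qed

end
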